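(* Let $0\le\varepsilon<1$, and suppose that a general source $\mathbf{V}=\{V^n\}_{n=1}^\infty$ is $\varepsilon$-transmissible over a general channel $\mathbf{W}=\{W^n\}_{n=1}^\infty$. Then there is some channel input $\mathbf{X}=\{X^n\}_{n=1}^\infty$, which may be arbitrarily correlated to the output of the source $\mathbf{V}$, such that for any sequence $\{\gamma_n\}_{n=1}^\infty$ of real numbers satisfying $$\gamma_n>0,\quad \gamma_n\to0\quad\text{and}\quad n\gamma_n\to\infty\qquad(n\to\infty)$$ it holds that $$\limsup_{n\to\infty}\Pr\left\{\frac1n\log\frac{W^n(Y^n|X^n)}{P_{Y^n}(Y^n)}\le\frac1n\log\frac1{P_{V^n}(V^n)}-\gamma_n\right\}\le\varepsilon,$$ where $Y^n$ is the channel output via $W^n$ due to the channel input $X^n$.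
   Context: A general source $\mathbf{V}=\{V^n\}_{n=1}^\infty$ is an arbitrary sequence of random variables $V^n=(V_1^{(n)},\dots,V_n^{(n)})$ with values in $\mathcal{V}^n$, where the source alphabet $\mathcal{V}$ is a countably infinite set; no consistency between different $n$ is required. A general channel $\mathbf{W}=\{W^n(\cdot|\cdot):\mathcal{X}^n\to\mathcal{Y}^n\}_{n=1}^\infty$ is an arbitrary sequence of transition probabilities (Markov kernels) $W^n$ from $\mathcal{X}^n$ to $\mathcal{Y}^n$, where $\mathcal{X},\mathcal{Y}$ are arbitrary abstract (measurable) alphabets. $P_Z$ denotes the distribution of $Z$. Logarithms are natural. A channel input $\mathbf{X}=\{X^n\}$ is a sequence of random variables $X^n$ with values in $\mathcal{X}^n$. "$Y^n$ is the channel output via $W^n$ due to the input $X^n$" means that the conditional distribution of $Y^n$ given $X^n=\mathbf{x}$ is $W^n(\cdot|\mathbf{x})$ and $V^n\to X^n\to Y^n$ is a Markov chain. For abstract alphabets, $\frac{W^n(Y^n|X^n)}{P_{Y^n}(Y^n)}$ means $g(Y^n|X^n)$, where $g(\mathbf{y}|\mathbf{x})=\frac{W^n(d\mathbf{y}|\mathbf{x})}{P_{Y^n}(d\mathbf{y})}=\frac{P_{X^nY^n}(d\mathbf{x},d\mathbf{y})}{P_{X^n}(d\mathbf{x})P_{Y^n}(d\mathbf{y})}$ is the Radon-Nikodym derivative, measurable in $(\mathbf{x},\mathbf{y})$. A joint source-channel $(n,\varepsilon_n)$ code is a pair of an encoder $\varphi_n:\mathcal{V}^n\to\mathcal{X}^n$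 and a decoder $\psi_n:\mathcal{Y}^n\to\mathcal{V}^n$ (deterministic maps) whose probability of decoding error is $\varepsilon_n=\sum_{\mathbf{v}\in\mathcal{V}^n}P_{V^n}(\mathbf{v})\,W^n(\mathcal{D}^c(\mathbf{v})|\varphi_n(\mathbf{v}))$, where $\mathcal{D}(\mathbf{v})=\{\mathbf{y}\in\mathcal{Y}^n:\psi_n(\mathbf{y})=\mathbf{v}\}$. The source $\mathbf{V}$ is $\varepsilon$-transmissible over the channel $\mathbf{W}$ if there exists a sequence of $(n,\varepsilon_n)$ codes with $\limsup_{n\to\infty}\varepsilon_n\le\varepsilon$. *)

theory Defs
  imports "HOL-Probability.Probability"
begin

text \<open>
  A word of length \<open>n\<close> is an extensional function on \<open>{1..n}\<close>.  Abstract channel alphabets are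
  given by (the measurable structure of) a measure \<open>M\<close>; \<open>block M n\<close> carries the product
  \<open>\<sigma>\<close>-algebra, and only its measurable structure is ever used.
  Sequences are indexed by \<open>n \<ge> 1\<close>; their value at \<open>n = 0\<close> is unconstrained.
\<close>

definition words :: "'v set \<Rightarrow> nat \<Rightarrow> (nat \<Rightarrow> 'v) set" where
  "words V n = PiE {1..n} (\<lambda>_. V)"

definition block :: "'a measure \<Rightarrow> nat \<Rightarrow> (nat \<Rightarrow> 'a) measure" where
  "block M n = PiM {1..n} (\<lambda>_. M)"

text \<open>A source is represented by the distributions \<open>P n\<close> of its blocks.\<close>

definition general_source :: "'v set \<Rightarrow> (nat \<Rightarrow> (nat \<Rightarrow> 'v) pmf) \<Rightarrow> bool" where
  "general_source V P \<longleftrightarrow>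
     countable V \<and> infinite V \<and> (\<forall>n\<ge>1. set_pmf (P n) \<subseteq> words V n)"

definition general_channel ::
  "'x measure \<Rightarrow> 'y measure \<Rightarrow> (nat \<Rightarrow> (nat \<Rightarrow> 'x) \<Rightarrow> (nat \<Rightarrow> 'y) measure) \<Rightarrow> bool" where
  "general_channel X Y W \<longleftrightarrow> (\<forall>n\<ge>1. W n \<in> block X n \<rightarrow>\<^sub>M prob_algebra (block Y n))"

text \<open>
  The source block takes values in a countable set, so every encoder is measurable; measurability
  of the decoder says exactly that its decoding regions are measurable.
\<close>

definition joint_code ::
  "'v set \<Rightarrow> 'x measure \<Rightarrow> 'y measure \<Rightarrow> nat
     \<Rightarrow> ((nat \<Rightarrow> 'v) \<Rightarrow> (nat \<Rightarrow> 'x)) \<Rightarrow> ((nat \<Rightarrow> 'y) \<Rightarrow> (nat \<Rightarrow> 'v)) \<Rightarrow> bool" where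
  "joint_code V X Y n \<phi> \<psi> \<longleftrightarrow>
     \<phi> \<in> words V n \<rightarrow> space (block X n) \<and>
     \<psi> \<in> block Y n \<rightarrow>\<^sub>M count_space (words V n)"

definition error_prob ::
  "'v set \<Rightarrow> 'y measure \<Rightarrow> nat \<Rightarrow> (nat \<Rightarrow> 'v) pmf \<Rightarrow> ((nat \<Rightarrow> 'x) \<Rightarrow> (nat \<Rightarrow> 'y) measure)
     \<Rightarrow> ((nat \<Rightarrow> 'v) \<Rightarrow> (nat \<Rightarrow> 'x)) \<Rightarrow> ((nat \<Rightarrow> 'y) \<Rightarrow> (nat \<Rightarrow> 'v)) \<Rightarrow> real" where
  "error_prob V Y n p w \<phi> \<psi> =
     (\<Sum>\<^sub>\<infinity>v\<in>words V n. pmf p v * measure (w (\<phi> v)) (space (block Y n) - {y \<in> space (block Y n). \<psi> y = v}))"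

definition transmissible ::
  "real \<Rightarrow> 'v set \<Rightarrow> (nat \<Rightarrow> (nat \<Rightarrow> 'v) pmf) \<Rightarrow> 'x measure \<Rightarrow> 'y measure
     \<Rightarrow> (nat \<Rightarrow> (nat \<Rightarrow> 'x) \<Rightarrow> (nat \<Rightarrow> 'y) measure) \<Rightarrow> bool" where
  "transmissible \<epsilon> V P X Y W \<longleftrightarrow>
     (\<exists>\<phi> \<psi>. (\<forall>n\<ge>1. joint_code V X Y n (\<phi> n) (\<psi> n)) \<and>
        limsup (\<lambda>n. ereal (error_prob V Y n (P n) (W n) (\<phi> n) (\<psi> n))) \<le> ereal \<epsilon>)"

text \<open>
  A channel input that may be arbitrarily correlated with the source: \<open>Q n\<close> is the joint
  distribution of the source block and the input block, so its first marginal is \<open>P n\<close>.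
\<close>

definition correlated_input ::
  "(nat \<Rightarrow> (nat \<Rightarrow> 'v) pmf) \<Rightarrow> 'x measure \<Rightarrow> (nat \<Rightarrow> ((nat \<Rightarrow> 'v) \<times> (nat \<Rightarrow> 'x)) measure) \<Rightarrow> bool" where
  "correlated_input P X Q \<longleftrightarrow>
     (\<forall>n\<ge>1. Q n \<in> space (prob_algebra (count_space UNIV \<Otimes>\<^sub>M block X n)) \<and>
            distr (Q n) (count_space UNIV) fst = measure_pmf (P n))"

text \<open>
  The joint law of (source block, channel input, channel output).  Given the first two components
  \<open>(v, x)\<close>, the output has law \<open>w x\<close>; this encodes both the conditional law of the output given
  the input and the Markov chain condition.
\<close>

definition joint_law ::
  "'x measure \<Rightarrow> 'y measure \<Rightarrow> nat \<Rightarrow> ((nat \<Rightarrow> 'v) \<times> (nat \<Rightarrow> 'x)) measure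
     \<Rightarrow> ((nat \<Rightarrow> 'x) \<Rightarrow> (nat \<Rightarrow> 'y) measure)
     \<Rightarrow> ((nat \<Rightarrow> 'v) \<times> (nat \<Rightarrow> 'x) \<times> (nat \<Rightarrow> 'y)) measure" where
  "joint_law X Y n q w =
     q \<bind> (\<lambda>(v, x). w x \<bind> (\<lambda>y.
       return (count_space UNIV \<Otimes>\<^sub>M (block X n \<Otimes>\<^sub>M block Y n)) (v, x, y)))"

text \<open>
  The ratio of the channel transition probability to the output distribution, as the
  Radon-Nikodym derivative of the joint input-output law with respect to the product of its
  marginals.  If the former is not absolutely continuous, \<open>RN_deriv\<close> is \<open>0\<close>, whose logarithm
  below is \<open>-\<infinity>\<close>; the event bounded in the theorem then has probability one, so such inputs
  gain nothing.
\<close>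

definition density_ratio ::
  "'x measure \<Rightarrow> 'y measure \<Rightarrow> nat \<Rightarrow> ((nat \<Rightarrow> 'v) \<times> (nat \<Rightarrow> 'x) \<times> (nat \<Rightarrow> 'y)) measure
     \<Rightarrow> (nat \<Rightarrow> 'x) \<times> (nat \<Rightarrow> 'y) \<Rightarrow> ennreal" where
  "density_ratio X Y n T =
     RN_deriv (distr T (block X n) (\<lambda>(v, x, y). x) \<Otimes>\<^sub>M distr T (block Y n) (\<lambda>(v, x, y). y))
              (distr T (block X n \<Otimes>\<^sub>M block Y n) snd)"

text \<open>The natural logarithm on \<open>[0, \<infinity>]\<close>; the real \<open>ln\<close> would give \<open>ln 0 = 0\<close>.\<close>

definition log_ennreal :: "ennreal \<Rightarrow> ereal" where
  "log_ennreal t = (if t = 0 then -\<infinity> else if t = \<infinity> then \<infinity> else ereal (ln (enn2real t)))"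

end

theory Submission
  imports Defs
begin

text \<open>
  The input that works is the encoder's own output, \<open>X\<^sup>n = \<phi>\<^sub>n(V\<^sup>n)\<close>.  Write \<open>g\<close> for the density
  ratio, \<open>P\<^sub>Y\<close> for the output law and \<open>c = exp (- n \<gamma>\<^sub>n)\<close>.  The event in question is, up to taking
  logarithms, \<open>g (\<phi> v, y) * P v \<le> c\<close>.  Split it according to whether \<open>y\<close> is decoded to \<open>v\<close>.  Where
  it is not, the probability is at most the error probability of the code.  Where it is, \<open>y\<close> lies
  in the decoding region \<open>D v\<close>, and a change of measure from \<open>W(\<cdot>|\<phi> v)\<close> to \<open>P\<^sub>Y\<close>
  gives
  \<open>P v * W({y \<in> D v. g (\<phi> v, y) * P v \<le> c}|\<phi> v) \<le> c * P\<^sub>Y(D v)\<close>, since the left-hand side integrates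
  \<open>P v * g (\<phi> v, y)\<close> over part of \<open>D v\<close> with respect to \<open>P\<^sub>Y\<close>.
  The decoding regions are disjoint, so summing over \<open>v\<close> contributes at most \<open>c\<close>
  (\<open>nn_integral_low_density_decoding_le\<close>).  Altogether the event has probability at most
  \<open>\<epsilon>\<^sub>n + c\<close> (\<open>low_density_prob_le_error_prob\<close>), and \<open>c \<longlonglongrightarrow> 0\<close> because \<open>n \<gamma>\<^sub>n \<longlonglongrightarrow> \<infinity>\<close>.  The input is
  built from the source and the codes alone, so the same one serves all sequences \<open>\<gamma>\<close>.

  On abstract alphabets the change of measure needs two facts.  The density must be a genuine one:
  the joint input-output law is absolutely continuous with respect to the product of its marginals
  as soon as the input is a function of a countably supported variable
  (\<open>discrete_input_absolutely_continuous\<close>).  And its section at \<open>\<phi> v\<close> must be the density of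
  \<open>W(\<cdot>|\<phi> v)\<close> for every single \<open>v\<close> of positive probability.  The point \<open>\<phi> v\<close> need not be a measurable
  singleton, but for a fixed output event the identity holds almost surely in the input law
  (\<open>AE_kernel_eq_nn_integral_density\<close>), hence at the image of every atom of the source.
\<close>

section \<open>Kernels driven by an input law\<close>

text \<open>
  Both sides are measurable functions of the input, and integrating them over an input event \<open>A\<close>
  gives the joint law of \<open>A \<times> B\<close> either way; functions with equal integrals over all events
  agree almost everywhere.  The exceptional set may depend on \<open>B\<close>, which is why \<open>B\<close> is
  fixed outside the almost-everywhere quantifier.
\<close>

lemma AE_kernel_eq_nn_integral_density:
  fixes g :: "'x \<times> 'y \<Rightarrow> ennreal"
  assumes K: "K \<in> M \<rightarrow>\<^sub>M subprob_algebra N"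
    and \<mu>: "prob_space \<mu>" "sets \<mu> = sets M"
    and \<nu>: "prob_space \<nu>" "sets \<nu> = sets N"
    and g: "g \<in> borel_measurable (M \<Otimes>\<^sub>M N)"
    and J: "\<And>A B. A \<in> sets M \<Longrightarrow> B \<in> sets N \<Longrightarrow>
      emeasure (density (\<mu> \<Otimes>\<^sub>M \<nu>) g) (A \<times> B) = (\<integral>\<^sup>+x. indicator A x * emeasure (K x) B \<partial>\<mu>)"
    and B: "B \<in> sets N"
  shows "AE x in \<mu>. emeasure (K x) B = (\<integral>\<^sup>+y. g (x, y) * indicator B y \<partial>\<nu>)"
proof -
  interpret \<mu>: prob_space \<mu> by fact
  interpret \<nu>: prob_space \<nu> by fact
  interpret pair_sigma_finite \<mu> \<nu> ..
  note [measurable_cong] = \<mu>(2) \<nu>(2)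
  note [measurable] = g K B
  have "density \<mu> (\<lambda>x. emeasure (K x) B) = density \<mu> (\<lambda>x. \<integral>\<^sup>+y. g (x, y) * indicator B y \<partial>\<nu>)"
  proof (rule measure_eqI)
    fix A assume "A \<in> sets (density \<mu> (\<lambda>x. emeasure (K x) B))"
    then have A[measurable]: "A \<in> sets M" by (simp add: \<mu>)
    have "(\<integral>\<^sup>+x. indicator A x * emeasure (K x) B \<partial>\<mu>) = emeasure (density (\<mu> \<Otimes>\<^sub>M \<nu>) g) (A \<times> B)"
      by (rule J[OF A B, symmetric])
    also have "\<dots> = (\<integral>\<^sup>+z. g z * indicator (A \<times> B) z \<partial>(\<mu> \<Otimes>\<^sub>M \<nu>))"
      by (subst emeasure_density) auto
    also have "\<dots> = (\<integral>\<^sup>+x. \<integral>\<^sup>+y. g (x, y) * indicator (A \<times> B) (x, y) \<partial>\<nu> \<partial>\<mu>)"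
      by (subst \<nu>.nn_integral_fst[symmetric]) auto
    also have "\<dots> = (\<integral>\<^sup>+x. (\<integral>\<^sup>+y. g (x, y) * indicator B y \<partial>\<nu>) * indicator A x \<partial>\<mu>)"
      by (intro nn_integral_cong) (auto simp: indicator_def)
    finally show "emeasure (density \<mu> (\<lambda>x. emeasure (K x) B)) A =
        emeasure (density \<mu> (\<lambda>x. \<integral>\<^sup>+y. g (x, y) * indicator B y \<partial>\<nu>)) A"
      by (subst (1 2) emeasure_density) (auto simp: mult.commute)
  qed simp
  then show ?thesis
    by (subst (asm) \<mu>.density_unique_iff) auto
qed

text \<open>
  The output law is a mixture that contains \<open>K (\<phi> v)\<close> with weight \<open>pmf p v\<close>.  A set that is null for the
  product of the marginals therefore has, for each \<open>v\<close> of positive weight, a section at \<open>\<phi> v\<close>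
  that is null for the output law, hence for \<open>K (\<phi> v)\<close>; these sections are all that the joint
  law sees.
\<close>

lemma discrete_input_absolutely_continuous:
  assumes \<phi>: "\<And>v. \<phi> v \<in> space M"
    and K: "K \<in> M \<rightarrow>\<^sub>M subprob_algebra N"
    and \<nu>: "prob_space \<nu>" "sets \<nu> = sets N"
    and emeasure_\<nu>: "\<And>B. B \<in> sets N \<Longrightarrow> emeasure \<nu> B = (\<integral>\<^sup>+v. emeasure (K (\<phi> v)) B \<partial>measure_pmf p)"
    and J: "sets J = sets (M \<Otimes>\<^sub>M N)"
    and emeasure_J: "\<And>C. C \<in> sets (M \<Otimes>\<^sub>M N) \<Longrightarrow>
      emeasure J C = (\<integral>\<^sup>+v. emeasure (K (\<phi> v)) (Pair (\<phi> v) -` C) \<partial>measure_pmf p)"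
  shows "absolutely_continuous (distr (measure_pmf p) M \<phi> \<Otimes>\<^sub>M \<nu>) J"
proof -
  interpret \<nu>: prob_space \<nu> by fact
  note [measurable_cong] = \<nu>(2)
  have [measurable]: "\<phi> \<in> measure_pmf p \<rightarrow>\<^sub>M M" using \<phi> by simp
  show ?thesis
    unfolding absolutely_continuous_def
  proof
    fix C assume C: "C \<in> null_sets (distr (measure_pmf p) M \<phi> \<Otimes>\<^sub>M \<nu>)"
    have "sets (distr (measure_pmf p) M \<phi> \<Otimes>\<^sub>M \<nu>) = sets (M \<Otimes>\<^sub>M N)"
      by (rule sets_pair_measure_cong) (simp_all add: \<nu>)
    with null_setsD2[OF C] have C': "C \<in> sets (M \<Otimes>\<^sub>M N)" by (simp only:)
    have sec: "Pair x -` C \<in> sets N" for x by (rule sets_Pair1) (rule C')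
    have C'': "C \<in> sets (M \<Otimes>\<^sub>M \<nu>)" using C' sets_pair_measure_cong[OF refl \<nu>(2), of M] by simp
    have "emeasure (distr (measure_pmf p) M \<phi> \<Otimes>\<^sub>M \<nu>) C
        = (\<integral>\<^sup>+x. emeasure \<nu> (Pair x -` C) \<partial>distr (measure_pmf p) M \<phi>)"
      by (rule \<nu>.emeasure_pair_measure_alt[OF null_setsD2[OF C]])
    also have "\<dots> = (\<integral>\<^sup>+v. emeasure \<nu> (Pair (\<phi> v) -` C) \<partial>measure_pmf p)"
      using \<nu>.measurable_emeasure_Pair[OF C''] by (intro nn_integral_distr) (simp_all add: \<phi>)
    finally have null: "AE v in measure_pmf p. emeasure \<nu> (Pair (\<phi> v) -` C) = 0"
      using null_setsD1[OF C] by (simp add: nn_integral_0_iff_AE)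
    \<comment> \<open>The \<open>v\<close>-th section is null for the whole mixture, so also for its \<open>v\<close>-th component.\<close>
    have diag: "emeasure (K (\<phi> v)) (Pair (\<phi> v) -` C) = 0" if v: "v \<in> set_pmf p" for v
    proof -
      have "(\<integral>\<^sup>+u. emeasure (K (\<phi> u)) (Pair (\<phi> v) -` C) \<partial>measure_pmf p) = 0"
        using null v emeasure_\<nu>[OF sec[of "\<phi> v"]] by (simp add: AE_measure_pmf_iff)
      with v show ?thesis by (simp add: nn_integral_0_iff_AE AE_measure_pmf_iff)
    qed
    have "emeasure J C = 0"
      unfolding emeasure_J[OF C'] using diag by (simp add: nn_integral_0_iff_AE AE_measure_pmf_iff)
    then show "C \<in> null_sets J" using J C' by (intro null_setsI) simp_all
  qed
qed

section \<open>The joint law produced by an encoder\<close>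

definition encoded_input :: "'x measure \<Rightarrow> ('v \<Rightarrow> 'x) \<Rightarrow> 'v pmf \<Rightarrow> ('v \<times> 'x) measure" where
  "encoded_input M \<phi> p = distr (measure_pmf p) (count_space UNIV \<Otimes>\<^sub>M M) (\<lambda>v. (v, \<phi> v))"

lemma measurable_graph:
  assumes "\<And>v. \<phi> v \<in> space M"
  shows "(\<lambda>v. (v, \<phi> v)) \<in> measure_pmf p \<rightarrow>\<^sub>M count_space UNIV \<Otimes>\<^sub>M M"
  using assms by (simp add: space_pair_measure)

lemma encoded_input_props:
  assumes "\<And>v. \<phi> v \<in> space M"
  shows "encoded_input M \<phi> p \<in> space (prob_algebra (count_space UNIV \<Otimes>\<^sub>M M))"
    and "distr (encoded_input M \<phi> p) (count_space UNIV) fst = measure_pmf p"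
proof -
  note G = measurable_graph[where p = p, OF assms]
  show "encoded_input M \<phi> p \<in> space (prob_algebra (count_space UNIV \<Otimes>\<^sub>M M))"
    using G by (simp add: encoded_input_def space_prob_algebra measure_pmf.prob_space_distr)
  have "distr (encoded_input M \<phi> p) (count_space UNIV) fst
      = distr (measure_pmf p) (count_space UNIV) (fst \<circ> (\<lambda>v. (v, \<phi> v)))"
    unfolding encoded_input_def by (intro distr_distr G) simp
  also have "\<dots> = distr (measure_pmf p) (measure_pmf p) (\<lambda>v. v)"
    by (intro distr_cong) auto
  finally show "distr (encoded_input M \<phi> p) (count_space UNIV) fst = measure_pmf p"
    by simp
qed

text \<open>
  An encoded input makes the joint law a countable mixture: draw \<open>v\<close>, then \<open>y\<close> from the
  channel at \<open>\<phi> v\<close>.  All later computations go through this formula, so that events only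
  have to be measured section by section.
\<close>

lemma joint_law_encoded_input:
  fixes w :: "(nat \<Rightarrow> 'x) \<Rightarrow> (nat \<Rightarrow> 'y) measure" and p :: "(nat \<Rightarrow> 'v) pmf"
  assumes \<phi>: "\<And>v. \<phi> v \<in> space (block X n)"
    and w: "w \<in> block X n \<rightarrow>\<^sub>M prob_algebra (block Y n)"
  defines "R \<equiv> count_space UNIV \<Otimes>\<^sub>M (block X n \<Otimes>\<^sub>M block Y n)"
  defines "T \<equiv> joint_law X Y n (encoded_input (block X n) \<phi> p) w"
  shows sets_joint_law_encoded: "sets T = sets R"
    and prob_space_joint_law_encoded: "prob_space T"
    and emeasure_joint_law_encoded: "\<And>C. C \<in> sets R \<Longrightarrow>
      emeasure T C = (\<integral>\<^sup>+v. emeasure (w (\<phi> v)) {y \<in> space (block Y n). (v, \<phi> v, y) \<in> C} \<partial>measure_pmf p)"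
proof -
  define Q where "Q = encoded_input (block X n) \<phi> p"
  define F where "F = (\<lambda>(v :: nat \<Rightarrow> 'v, x). w x \<bind> (\<lambda>y. return R (v, x, y)))"
  have Q: "Q \<in> space (prob_algebra (count_space UNIV \<Otimes>\<^sub>M block X n))"
    unfolding Q_def by (rule encoded_input_props) (rule \<phi>)
  have F[measurable]: "F \<in> count_space UNIV \<Otimes>\<^sub>M block X n \<rightarrow>\<^sub>M prob_algebra R"
    using w unfolding F_def R_def by measurable
  have T: "T = Q \<bind> F" unfolding T_def joint_law_def Q_def F_def R_def ..
  show setsT: "sets T = sets R"
    unfolding T
    by (rule sets_bind'[OF Q F])
  show "prob_space T" unfolding T by (rule prob_space_bind'[OF Q F])
  fix C assume C[measurable]: "C \<in> sets R"
  have FE: "(\<lambda>z. emeasure (F z) C) \<in> borel_measurable (count_space UNIV \<Otimes>\<^sub>M block X n)"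
    using measurable_prob_algebraD[OF F] C by measurable
  have "emeasure T C = (\<integral>\<^sup>+z. emeasure (F z) C \<partial>Q)"
    unfolding T by (rule emeasure_bind_prob_algebra[OF Q F C])
  also have "\<dots> = (\<integral>\<^sup>+v. emeasure (F (v, \<phi> v)) C \<partial>measure_pmf p)"
    unfolding Q_def encoded_input_def by (subst nn_integral_distr[OF measurable_graph[OF \<phi>]]) (auto intro: FE)
  also have "\<dots> = (\<integral>\<^sup>+v. emeasure (w (\<phi> v)) {y \<in> space (block Y n). (v, \<phi> v, y) \<in> C} \<partial>measure_pmf p)"
  proof (intro nn_integral_cong)
    fix v
    have wv: "w (\<phi> v) \<in> space (prob_algebra (block Y n))"
      using measurable_space[OF w \<phi>] .
    have m[measurable]: "(\<lambda>y. (v, \<phi> v, y)) \<in> block Y n \<rightarrow>\<^sub>M R"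
      unfolding R_def using \<phi>[of v] by measurable
    have s: "sets (w (\<phi> v)) = sets (block Y n)" using wv by (simp add: space_prob_algebra)
    have "emeasure (F (v, \<phi> v)) C = emeasure (w (\<phi> v) \<bind> (\<lambda>y. return R (v, \<phi> v, y))) C"
      by (simp add: F_def)
    also have "\<dots> = (\<integral>\<^sup>+y. emeasure (return R (v, \<phi> v, y)) C \<partial>w (\<phi> v))"
      by (rule emeasure_bind_prob_algebra[OF wv _ C]) measurable
    also have "\<dots> = (\<integral>\<^sup>+y. indicator {y \<in> space (block Y n). (v, \<phi> v, y) \<in> C} y \<partial>w (\<phi> v))"
      using sets_eq_imp_space_eq[OF s] by (intro nn_integral_cong) (auto simp: indicator_def)
    also have "\<dots> = emeasure (w (\<phi> v)) {y \<in> space (block Y n). (v, \<phi> v, y) \<in> C}"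
      using s measurable_sets[OF m C]
      by (intro nn_integral_indicator) (auto simp: vimage_def Int_def conj_commute)
    finally show "emeasure (F (v, \<phi> v)) C
        = emeasure (w (\<phi> v)) {y \<in> space (block Y n). (v, \<phi> v, y) \<in> C}" .
  qed
  finally show "emeasure T C =
    (\<integral>\<^sup>+v. emeasure (w (\<phi> v)) {y \<in> space (block Y n). (v, \<phi> v, y) \<in> C} \<partial>measure_pmf p)" .
qed


lemma joint_law_encoded_marginals:
  fixes w :: "(nat \<Rightarrow> 'x) \<Rightarrow> (nat \<Rightarrow> 'y) measure" and p :: "(nat \<Rightarrow> 'v) pmf"
  assumes \<phi>: "\<And>v. \<phi> v \<in> space (block X n)"
    and w: "w \<in> block X n \<rightarrow>\<^sub>M prob_algebra (block Y n)"
  defines "T \<equiv> joint_law X Y n (encoded_input (block X n) \<phi> p) w"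
  shows distr_joint_law_input: "distr T (block X n) (\<lambda>(v, x, y). x) = distr (measure_pmf p) (block X n) \<phi>"
    and prob_space_joint_law_output: "prob_space (distr T (block Y n) (\<lambda>(v, x, y). y))"
    and emeasure_joint_law_output: "\<And>B. B \<in> sets (block Y n) \<Longrightarrow>
      emeasure (distr T (block Y n) (\<lambda>(v, x, y). y)) B = (\<integral>\<^sup>+v. emeasure (w (\<phi> v)) B \<partial>measure_pmf p)"
    and emeasure_joint_law_input_output: "\<And>C. C \<in> sets (block X n \<Otimes>\<^sub>M block Y n) \<Longrightarrow>
      emeasure (distr T (block X n \<Otimes>\<^sub>M block Y n) snd) C
        = (\<integral>\<^sup>+v. emeasure (w (\<phi> v)) (Pair (\<phi> v) -` C) \<partial>measure_pmf p)"
proof -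
  let ?R = "count_space (UNIV :: (nat \<Rightarrow> 'v) set) \<Otimes>\<^sub>M (block X n \<Otimes>\<^sub>M block Y n)"
  have [measurable_cong]: "sets T = sets ?R"
    unfolding T_def by (rule sets_joint_law_encoded[OF \<phi> w])
  then have spT: "space T = space ?R" by (rule sets_eq_imp_space_eq)
  have em: "emeasure T C = (\<integral>\<^sup>+v. emeasure (w (\<phi> v)) {y \<in> space (block Y n). (v, \<phi> v, y) \<in> C} \<partial>measure_pmf p)"
    if "C \<in> sets ?R" for C
    unfolding T_def using that by (rule emeasure_joint_law_encoded[OF \<phi> w])
  have wv: "prob_space (w (\<phi> v))" "space (w (\<phi> v)) = space (block Y n)" for v
    using measurable_space[OF w \<phi>[of v]] by (auto simp: space_prob_algebra dest: sets_eq_imp_space_eq)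
  interpret T: prob_space T
    unfolding T_def by (rule prob_space_joint_law_encoded[OF \<phi> w])
  have [measurable]: "(\<lambda>(v, x, y). x) \<in> T \<rightarrow>\<^sub>M block X n" "(\<lambda>(v, x, y). y) \<in> T \<rightarrow>\<^sub>M block Y n"
    "snd \<in> T \<rightarrow>\<^sub>M block X n \<Otimes>\<^sub>M block Y n"
    by measurable
  show "prob_space (distr T (block Y n) (\<lambda>(v, x, y). y))"
    by (rule T.prob_space_distr) measurable
  show "distr T (block X n) (\<lambda>(v, x, y). x) = distr (measure_pmf p) (block X n) \<phi>"
  proof (rule measure_eqI)
    fix A assume "A \<in> sets (distr T (block X n) (\<lambda>(v, x, y). x))"
    then have A[measurable]: "A \<in> sets (block X n)" by simp
    have "emeasure (distr T (block X n) (\<lambda>(v, x, y). x)) A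
        = emeasure T ((\<lambda>(v, x, y). x) -` A \<inter> space T)"
      by (rule emeasure_distr) measurable
    also have "\<dots> = (\<integral>\<^sup>+v. emeasure (w (\<phi> v)) {y \<in> space (block Y n).
        (v, \<phi> v, y) \<in> (\<lambda>(v, x, y). x) -` A \<inter> space T} \<partial>measure_pmf p)"
      using A by (intro em) (metis \<open>sets T = sets ?R\<close> \<open>(\<lambda>(v, x, y). x) \<in> T \<rightarrow>\<^sub>M block X n\<close> measurable_sets)
    also have "\<dots> = (\<integral>\<^sup>+v. indicator (\<phi> -` A) v \<partial>measure_pmf p)"
    proof (intro nn_integral_cong)
      fix v
      have "{y \<in> space (block Y n). (v, \<phi> v, y) \<in> (\<lambda>(v, x, y). x) -` A \<inter> space T}
          = (if \<phi> v \<in> A then space (w (\<phi> v)) else {})"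
        using \<phi> by (auto simp: spT wv space_pair_measure)
      then show "emeasure (w (\<phi> v)) {y \<in> space (block Y n). (v, \<phi> v, y) \<in> (\<lambda>(v, x, y). x) -` A \<inter> space T}
          = indicator (\<phi> -` A) v"
        using prob_space.emeasure_space_1[OF wv(1)] by auto
    qed
    also have "\<dots> = emeasure (distr (measure_pmf p) (block X n) \<phi>) A"
      using \<phi> A by (subst emeasure_distr) auto
    finally show "emeasure (distr T (block X n) (\<lambda>(v, x, y). x)) A
        = emeasure (distr (measure_pmf p) (block X n) \<phi>) A" .
  qed simp
  show "emeasure (distr T (block Y n) (\<lambda>(v, x, y). y)) B = (\<integral>\<^sup>+v. emeasure (w (\<phi> v)) B \<partial>measure_pmf p)"
    if B[measurable]: "B \<in> sets (block Y n)" for B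
  proof -
    have "emeasure (distr T (block Y n) (\<lambda>(v, x, y). y)) B
        = emeasure T ((\<lambda>(v, x, y). y) -` B \<inter> space T)"
      by (rule emeasure_distr) measurable
    also have "\<dots> = (\<integral>\<^sup>+v. emeasure (w (\<phi> v)) {y \<in> space (block Y n).
        (v, \<phi> v, y) \<in> (\<lambda>(v, x, y). y) -` B \<inter> space T} \<partial>measure_pmf p)"
      using B by (intro em) (metis \<open>sets T = sets ?R\<close> \<open>(\<lambda>(v, x, y). y) \<in> T \<rightarrow>\<^sub>M block Y n\<close> measurable_sets)
    also have "\<dots> = (\<integral>\<^sup>+v. emeasure (w (\<phi> v)) B \<partial>measure_pmf p)"
      using \<phi> sets.sets_into_space[OF B]
      by (intro nn_integral_cong arg_cong2[where f=emeasure]) (auto simp: spT space_pair_measure)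
    finally show ?thesis .
  qed
  show "emeasure (distr T (block X n \<Otimes>\<^sub>M block Y n) snd) C
        = (\<integral>\<^sup>+v. emeasure (w (\<phi> v)) (Pair (\<phi> v) -` C) \<partial>measure_pmf p)"
    if C[measurable]: "C \<in> sets (block X n \<Otimes>\<^sub>M block Y n)" for C
  proof -
    have "emeasure (distr T (block X n \<Otimes>\<^sub>M block Y n) snd) C = emeasure T (snd -` C \<inter> space T)"
      by (rule emeasure_distr) measurable
    also have "\<dots> = (\<integral>\<^sup>+v. emeasure (w (\<phi> v)) {y \<in> space (block Y n).
        (v, \<phi> v, y) \<in> snd -` C \<inter> space T} \<partial>measure_pmf p)"
      using C by (intro em) (metis \<open>sets T = sets ?R\<close> \<open>snd \<in> T \<rightarrow>\<^sub>M block X n \<Otimes>\<^sub>M block Y n\<close> measurable_sets)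
    also have "\<dots> = (\<integral>\<^sup>+v. emeasure (w (\<phi> v)) (Pair (\<phi> v) -` C) \<partial>measure_pmf p)"
      using \<phi> sets.sets_into_space[OF C]
      by (intro nn_integral_cong arg_cong2[where f=emeasure]) (auto simp: spT space_pair_measure)
    finally show ?thesis .
  qed
qed

section \<open>Decoding regions and low information density\<close>

text \<open>
  This is the converse argument proper.  On the event, the density of the channel law at \<open>\<phi> v\<close> is at
  most \<open>c / pmf p v\<close>; the factor \<open>pmf p v\<close> cancels against the averaging over the source, leaving
  \<open>c\<close> times the output probability of the decoding region of \<open>v\<close>.  Disjointness of the
  decoding regions bounds the sum.
\<close>

lemma nn_integral_low_density_decoding_le:
  fixes g :: "'x \<times> 'y \<Rightarrow> ennreal" and c :: ennreal
  assumes \<phi>: "\<And>v. \<phi> v \<in> space M"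
    and \<nu>: "prob_space \<nu>" "sets \<nu> = sets N"
    and g: "g \<in> borel_measurable (M \<Otimes>\<^sub>M N)"
    and S: "countable S" "set_pmf p \<subseteq> S"
    and \<psi>: "\<psi> \<in> N \<rightarrow>\<^sub>M count_space S"
    and K: "\<And>v B. v \<in> set_pmf p \<Longrightarrow> B \<in> sets N \<Longrightarrow>
      emeasure (K (\<phi> v)) B = (\<integral>\<^sup>+y. g (\<phi> v, y) * indicator B y \<partial>\<nu>)"
  shows "(\<integral>\<^sup>+v. emeasure (K (\<phi> v)) {y \<in> space N. \<psi> y = v \<and> g (\<phi> v, y) * ennreal (pmf p v) \<le> c} \<partial>measure_pmf p) \<le> c"
proof -
  interpret \<nu>: prob_space \<nu> by fact
  note [measurable_cong] = \<nu>(2)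
  note [measurable] = g \<phi>
  define D where "D = (\<lambda>v. {y \<in> space N. \<psi> y = v})"
  have D[measurable]: "D v \<in> sets N" if "v \<in> S" for v
  proof -
    have "\<psi> -` {v} \<inter> space N \<in> sets N" using \<psi> that by (intro measurable_sets[OF \<psi>]) auto
    moreover have "\<psi> -` {v} \<inter> space N = D v" by (auto simp: D_def)
    ultimately show ?thesis by simp
  qed
  define E where "E = (\<lambda>v. {y \<in> space N. \<psi> y = v \<and> g (\<phi> v, y) * ennreal (pmf p v) \<le> c})"
  have E_eq: "E v = D v \<inter> {y \<in> space N. g (\<phi> v, y) * ennreal (pmf p v) \<le> c}" for v
    by (auto simp: E_def D_def)
  \<comment> \<open>Multiplying by \<open>pmf p v\<close> instead of dividing by it covers \<open>v\<close> of probability zero as well.\<close>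
  have bound: "ennreal (pmf p v) * emeasure (K (\<phi> v)) (E v) \<le> c * emeasure \<nu> (D v) * indicator S v" for v
  proof (cases "v \<in> set_pmf p")
    case True
    with S have v: "v \<in> S" by auto
    have sec[measurable]: "(\<lambda>y. g (\<phi> v, y)) \<in> borel_measurable N" by measurable
    have E[measurable]: "E v \<in> sets N" unfolding E_eq using D[OF v] by measurable
    have "ennreal (pmf p v) * emeasure (K (\<phi> v)) (E v) = (\<integral>\<^sup>+y. ennreal (pmf p v) * (g (\<phi> v, y) * indicator (E v) y) \<partial>\<nu>)"
      by (subst K[OF True E], subst nn_integral_cmult) auto
    also have "\<dots> \<le> (\<integral>\<^sup>+y. c * indicator (D v) y \<partial>\<nu>)"
      by (intro nn_integral_mono) (auto simp: E_eq indicator_def mult.commute)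
    also have "\<dots> = c * emeasure \<nu> (D v)"
      using D[OF v] \<nu>(2) by (subst nn_integral_cmult_indicator) auto
    finally show ?thesis using v by simp
  qed (simp add: set_pmf_iff)
  have "(\<integral>\<^sup>+v. emeasure (K (\<phi> v)) (E v) \<partial>measure_pmf p)
      = (\<integral>\<^sup>+v. ennreal (pmf p v) * emeasure (K (\<phi> v)) (E v) \<partial>count_space UNIV)"
    by (rule nn_integral_measure_pmf)
  also have "\<dots> \<le> (\<integral>\<^sup>+v. c * emeasure \<nu> (D v) * indicator S v \<partial>count_space UNIV)"
    by (intro nn_integral_mono bound)
  also have "\<dots> = c * (\<integral>\<^sup>+v. emeasure \<nu> (D v) \<partial>count_space S)"
    by (simp add: nn_integral_count_space_indicator nn_integral_cmult mult.assoc)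
  also have "(\<integral>\<^sup>+v. emeasure \<nu> (D v) \<partial>count_space S) = emeasure \<nu> (\<Union>(D ` S))"
    using S(1) D \<nu>(2) by (intro emeasure_UN_countable[symmetric]) (auto simp: disjoint_family_on_def D_def)
  also have "c * \<dots> \<le> c * 1"
    by (intro mult_left_mono \<nu>.emeasure_le_1) simp
  finally show ?thesis by (simp add: E_def)
qed

lemma nn_integral_measure_pmf_eq_infsum:
  fixes f :: "'v \<Rightarrow> real"
  assumes S: "set_pmf p \<subseteq> S" and f: "\<And>v. 0 \<le> f v" "\<And>v. f v \<le> 1"
  shows "(\<integral>\<^sup>+v. ennreal (f v) \<partial>measure_pmf p) = ennreal (\<Sum>\<^sub>\<infinity>v\<in>S. pmf p v * f v)"
proof -
  have abs: "Infinite_Set_Sum.abs_summable_on (\<lambda>v. pmf p v * f v) S"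
    using f by (intro Infinite_Set_Sum.abs_summable_on_comparison_test[OF pmf_abs_summable[of p S]])
      (auto simp: abs_mult mult_left_le)
  have "(\<integral>\<^sup>+v. ennreal (f v) \<partial>measure_pmf p) = (\<integral>\<^sup>+v. ennreal (pmf p v * f v) \<partial>count_space UNIV)"
    using f by (simp add: nn_integral_measure_pmf ennreal_mult)
  also have "\<dots> = (\<integral>\<^sup>+v. ennreal (pmf p v * f v) \<partial>count_space S)"
  proof -
    have "pmf p v = 0" if "v \<notin> S" for v using S that by (auto simp: set_pmf_iff)
    then show ?thesis
      by (auto simp: nn_integral_count_space_indicator indicator_def intro!: nn_integral_cong)
  qed
  also have "\<dots> = ennreal (infsetsum (\<lambda>v. pmf p v * f v) S)"
    using f abs by (intro nn_integral_conv_infsetsum) auto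
  also have "infsetsum (\<lambda>v. pmf p v * f v) S = (\<Sum>\<^sub>\<infinity>v\<in>S. pmf p v * f v)"
    using abs by (rule infsetsum_infsum)
  finally show ?thesis .
qed


text \<open>
  The non-asymptotic form of the converse: every code makes the event of low density at most
  \<open>c\<close> more likely than its decoding error, because the event is either a decoding error or a
  correct decoding at low density.  Measurability of the event in \<open>T\<close> is stated
  separately because the theorem's event, given by logarithms, is bounded by inclusion in it.
\<close>

lemma low_density_prob_le_error_prob:
  fixes p :: "(nat \<Rightarrow> 'v) pmf" and w :: "(nat \<Rightarrow> 'x) \<Rightarrow> (nat \<Rightarrow> 'y) measure"
  assumes V: "countable V" "set_pmf p \<subseteq> words V n"
    and w: "w \<in> block X n \<rightarrow>\<^sub>M prob_algebra (block Y n)"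
    and \<phi>: "\<And>v. \<phi> v \<in> space (block X n)"
    and \<psi>: "\<psi> \<in> block Y n \<rightarrow>\<^sub>M count_space (words V n)"
    and c: "0 \<le> c"
  defines "T \<equiv> joint_law X Y n (encoded_input (block X n) \<phi> p) w"
  shows "\<P>((v, x, y) in T. density_ratio X Y n T (x, y) * ennreal (pmf p v) \<le> ennreal c)
    \<le> error_prob V Y n p w \<phi> \<psi> + c"
    and "{(v, x, y) \<in> space T. density_ratio X Y n T (x, y) * ennreal (pmf p v) \<le> ennreal c} \<in> sets T"
proof -
  let ?M = "block X n" and ?N = "block Y n" and ?S = "words V n"
  let ?R = "count_space (UNIV :: (nat \<Rightarrow> 'v) set) \<Otimes>\<^sub>M (?M \<Otimes>\<^sub>M ?N)"
  define \<nu> where "\<nu> = distr T ?N (\<lambda>(v, x, y). y)"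
  define \<mu> where "\<mu> = distr (measure_pmf p) ?M \<phi>"
  define J where "J = distr T (?M \<Otimes>\<^sub>M ?N) snd"
  define g where "g = density_ratio X Y n T"
  have S: "countable ?S"
    unfolding words_def using V(1) by (intro countable_PiE) auto
  have w': "w \<in> ?M \<rightarrow>\<^sub>M subprob_algebra ?N" by (rule measurable_prob_algebraD[OF w])
  have wv: "prob_space (w (\<phi> v))" "sets (w (\<phi> v)) = sets ?N" "space (w (\<phi> v)) = space ?N" for v
    using measurable_space[OF w \<phi>[of v]] by (auto simp: space_prob_algebra dest: sets_eq_imp_space_eq)
  have \<mu>: "prob_space \<mu>" "sets \<mu> = sets ?M"
    unfolding \<mu>_def using \<phi> by (auto intro!: measure_pmf.prob_space_distr)
  have \<nu>: "prob_space \<nu>" "sets \<nu> = sets ?N"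
    unfolding \<nu>_def T_def using prob_space_joint_law_output[OF \<phi> w] by simp_all
  interpret \<mu>: prob_space \<mu> by fact
  interpret \<nu>: prob_space \<nu> by fact
  interpret pair_sigma_finite \<mu> \<nu> ..
  interpret T: prob_space T
    unfolding T_def by (rule prob_space_joint_law_encoded[OF \<phi> w])
  have em\<nu>: "emeasure \<nu> B = (\<integral>\<^sup>+v. emeasure (w (\<phi> v)) B \<partial>measure_pmf p)" if "B \<in> sets ?N" for B
    unfolding \<nu>_def T_def using that by (rule emeasure_joint_law_output[OF \<phi> w])
  have emJ: "emeasure J C = (\<integral>\<^sup>+v. emeasure (w (\<phi> v)) (Pair (\<phi> v) -` C) \<partial>measure_pmf p)"
    if "C \<in> sets (?M \<Otimes>\<^sub>M ?N)" for C
    unfolding J_def T_def using that by (rule emeasure_joint_law_input_output[OF \<phi> w])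
  have setsJ: "sets J = sets (?M \<Otimes>\<^sub>M ?N)" by (simp add: J_def)
  have sets\<mu>\<nu>: "sets (\<mu> \<Otimes>\<^sub>M \<nu>) = sets (?M \<Otimes>\<^sub>M ?N)"
    using \<mu> \<nu> by (intro sets_pair_measure_cong) auto
  have ac: "absolutely_continuous (\<mu> \<Otimes>\<^sub>M \<nu>) J"
    unfolding \<mu>_def by (rule discrete_input_absolutely_continuous[OF \<phi> w' \<nu> em\<nu> setsJ emJ])
  have g_RN: "g = RN_deriv (\<mu> \<Otimes>\<^sub>M \<nu>) J"
    unfolding g_def density_ratio_def \<mu>_def \<nu>_def J_def T_def
    by (subst distr_joint_law_input[OF \<phi> w]) simp
  have g[measurable]: "g \<in> borel_measurable (?M \<Otimes>\<^sub>M ?N)"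
    unfolding g_RN using borel_measurable_RN_deriv sets\<mu>\<nu> by (subst measurable_cong_sets[OF sets\<mu>\<nu>[symmetric] refl]) auto
  have density: "density (\<mu> \<Otimes>\<^sub>M \<nu>) g = J"
    unfolding g_RN using ac setsJ sets\<mu>\<nu> by (intro density_RN_deriv) auto
  have K: "emeasure (w (\<phi> v)) B = (\<integral>\<^sup>+y. g (\<phi> v, y) * indicator B y \<partial>\<nu>)"
    if v: "v \<in> set_pmf p" and B: "B \<in> sets ?N" for v B
  proof -
    have "AE x in \<mu>. emeasure (w x) B = (\<integral>\<^sup>+y. g (x, y) * indicator B y \<partial>\<nu>)"
    proof (rule AE_kernel_eq_nn_integral_density[OF w' \<mu> \<nu> g _ B])
      fix A C assume A: "A \<in> sets ?M" and C: "C \<in> sets ?N"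
      have "emeasure J (A \<times> C) = (\<integral>\<^sup>+v. emeasure (w (\<phi> v)) (Pair (\<phi> v) -` (A \<times> C)) \<partial>measure_pmf p)"
        using A C by (intro emJ) auto
      also have "\<dots> = (\<integral>\<^sup>+v. indicator A (\<phi> v) * emeasure (w (\<phi> v)) C \<partial>measure_pmf p)"
        by (intro nn_integral_cong) (auto simp: indicator_def)
      also have "\<dots> = (\<integral>\<^sup>+x. indicator A x * emeasure (w x) C \<partial>\<mu>)"
      proof -
        have "(\<lambda>x. indicator A x * emeasure (w x) C) \<in> borel_measurable ?M"
          using w' A C by measurable
        then show ?thesis
          unfolding \<mu>_def using \<phi> by (subst nn_integral_distr) auto
      qed
      finally show "emeasure (density (\<mu> \<Otimes>\<^sub>M \<nu>) g) (A \<times> C) = (\<integral>\<^sup>+x. indicator A x * emeasure (w x) C \<partial>\<mu>)"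
        by (simp only: density)
    qed
    then have "AE v in measure_pmf p. emeasure (w (\<phi> v)) B = (\<integral>\<^sup>+y. g (\<phi> v, y) * indicator B y \<partial>\<nu>)"
      unfolding \<mu>_def using \<phi> by (intro AE_distrD[of \<phi>]) auto
    then show ?thesis using v by (auto simp: AE_measure_pmf_iff)
  qed

  have setsT[measurable_cong]: "sets T = sets ?R"
    unfolding T_def by (rule sets_joint_law_encoded[OF \<phi> w])
  then have spT: "space T = space ?R" by (rule sets_eq_imp_space_eq)
  define L where "L = {(v, x, y) \<in> space T. g (x, y) * ennreal (pmf p v) \<le> ennreal c}"
  have L[measurable]: "L \<in> sets T"
  proof -
    have "L = {z \<in> space ?R. g (snd z) * ennreal (pmf p (fst z)) \<le> ennreal c}"
      by (auto simp: L_def spT)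
    also have "\<dots> \<in> sets ?R"
    proof -
      have [measurable]: "(\<lambda>z. pmf p (fst z)) \<in> borel_measurable ?R"
        by (rule measurable_compose[OF measurable_fst]) simp
      show ?thesis by measurable
    qed
    finally show ?thesis by (simp only: setsT)
  qed
  then show "{(v, x, y) \<in> space T. density_ratio X Y n T (x, y) * ennreal (pmf p v) \<le> ennreal c} \<in> sets T"
    by (simp add: L_def g_def)

  have D: "{y \<in> space ?N. \<psi> y = v} \<in> sets ?N" for v
  proof (cases "v \<in> ?S")
    case True
    then have "\<psi> -` {v} \<inter> space ?N \<in> sets ?N" by (intro measurable_sets[OF \<psi>]) auto
    then show ?thesis by (simp add: vimage_def Int_def conj_commute)
  next
    case False
    then have "{y \<in> space ?N. \<psi> y = v} = {}" using measurable_space[OF \<psi>] by auto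
    then show ?thesis by (simp only: sets.empty_sets)
  qed
  define E where "E = (\<lambda>v. {y \<in> space ?N. \<psi> y = v \<and> g (\<phi> v, y) * ennreal (pmf p v) \<le> ennreal c})"
  define F where "F = (\<lambda>v. space ?N - {y \<in> space ?N. \<psi> y = v})"
  have E: "E v \<in> sets ?N" for v
  proof -
    have "(\<lambda>y. g (\<phi> v, y)) \<in> borel_measurable ?N" using \<phi>[of v] by measurable
    then have "{y \<in> space ?N. g (\<phi> v, y) * ennreal (pmf p v) \<le> ennreal c} \<in> sets ?N" by measurable
    from sets.Int[OF D this, of v] show ?thesis by (auto simp: E_def Int_def conj_ac)
  qed
  have F: "F v \<in> sets ?N" for v unfolding F_def using D by auto
  \<comment> \<open>Each section of \<open>L\<close> is covered by the decoding errors \<open>F v\<close> and the correctly decoded part \<open>E v\<close>.\<close>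
  have "emeasure T L = (\<integral>\<^sup>+v. emeasure (w (\<phi> v)) {y \<in> space ?N. (v, \<phi> v, y) \<in> L} \<partial>measure_pmf p)"
    unfolding T_def using L setsT by (intro emeasure_joint_law_encoded[OF \<phi> w]) simp
  also have "\<dots> \<le> (\<integral>\<^sup>+v. emeasure (w (\<phi> v)) (F v) + emeasure (w (\<phi> v)) (E v) \<partial>measure_pmf p)"
  proof (intro nn_integral_mono)
    fix v
    have "emeasure (w (\<phi> v)) {y \<in> space ?N. (v, \<phi> v, y) \<in> L} \<le> emeasure (w (\<phi> v)) (F v \<union> E v)"
      using E F wv by (intro emeasure_mono) (auto simp: L_def E_def F_def)
    also have "\<dots> \<le> emeasure (w (\<phi> v)) (F v) + emeasure (w (\<phi> v)) (E v)"
      using E F wv by (intro emeasure_subadditive) auto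
    finally show "emeasure (w (\<phi> v)) {y \<in> space ?N. (v, \<phi> v, y) \<in> L}
      \<le> emeasure (w (\<phi> v)) (F v) + emeasure (w (\<phi> v)) (E v)" .
  qed
  also have "\<dots> = (\<integral>\<^sup>+v. emeasure (w (\<phi> v)) (F v) \<partial>measure_pmf p)
      + (\<integral>\<^sup>+v. emeasure (w (\<phi> v)) (E v) \<partial>measure_pmf p)"
    by (intro nn_integral_add) auto
  also have "(\<integral>\<^sup>+v. emeasure (w (\<phi> v)) (F v) \<partial>measure_pmf p) = ennreal (error_prob V Y n p w \<phi> \<psi>)"
  proof -
    have "(\<integral>\<^sup>+v. emeasure (w (\<phi> v)) (F v) \<partial>measure_pmf p)
        = (\<integral>\<^sup>+v. ennreal (measure (w (\<phi> v)) (F v)) \<partial>measure_pmf p)"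
      by (intro nn_integral_cong finite_measure.emeasure_eq_measure prob_space.finite_measure wv)
    also have "\<dots> = ennreal (\<Sum>\<^sub>\<infinity>v\<in>?S. pmf p v * measure (w (\<phi> v)) (F v))"
      by (intro nn_integral_measure_pmf_eq_infsum V prob_space.prob_le_1 wv) simp
    finally show ?thesis by (simp add: error_prob_def F_def)
  qed
  also have "(\<integral>\<^sup>+v. emeasure (w (\<phi> v)) (E v) \<partial>measure_pmf p) \<le> ennreal c"
    unfolding E_def by (rule nn_integral_low_density_decoding_le[where \<phi> = \<phi> and K = w, OF \<phi> \<nu> g S V(2) \<psi> K])
  finally have "emeasure T L \<le> ennreal (error_prob V Y n p w \<phi> \<psi>) + ennreal c" by simp
  moreover have e: "0 \<le> error_prob V Y n p w \<phi> \<psi>"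
    unfolding error_prob_def by (intro infsum_nonneg) simp
  ultimately have "ennreal (measure T L) \<le> ennreal (error_prob V Y n p w \<phi> \<psi> + c)"
    using c by (simp only: T.emeasure_eq_measure ennreal_plus)
  then have "measure T L \<le> error_prob V Y n p w \<phi> \<psi> + c"
    using c e by (subst (asm) ennreal_le_iff) simp_all
  then show "\<P>((v, x, y) in T. density_ratio X Y n T (x, y) * ennreal (pmf p v) \<le> ennreal c)
    \<le> error_prob V Y n p w \<phi> \<psi> + c"
    by (simp add: L_def g_def case_prod_beta')
qed

section \<open>Normalised information densities\<close>

text \<open>
  Away from \<open>0\<close> and \<open>\<infinity>\<close> this is exponentiation.  It survives at the extreme values:
  for \<open>t = 0\<close> or \<open>q = 0\<close> the product vanishes, and for \<open>t = \<infinity>\<close> with \<open>q > 0\<close> the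
  left-hand side of the hypothesis is \<open>\<infinity>\<close> while the right-hand side is finite.
\<close>

lemma log_ennreal_le_imp_mult_le:
  fixes n :: nat and q \<gamma> :: real and t :: ennreal
  assumes n: "n \<ge> 1" and q: "0 \<le> q"
    and le: "ereal (1 / real n) * log_ennreal t
      \<le> ereal (1 / real n) * log_ennreal (1 / ennreal q) - ereal \<gamma>"
  shows "t * ennreal q \<le> ennreal (exp (- (real n * \<gamma>)))"
proof (cases "q = 0 \<or> t = 0")
  case False
  then have q: "q > 0" and t: "t \<noteq> 0" using q by auto
  have inv: "1 / ennreal q = ennreal (1 / q)" using q by (simp add: divide_ennreal flip: ennreal_1)
  then have rhs: "log_ennreal (1 / ennreal q) = ereal (- ln q)"
    using q by (simp add: log_ennreal_def ln_div)
  show ?thesis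
  proof (cases t)
    case (real r)
    with t have r: "r > 0" by (cases "r = 0") auto
    have "log_ennreal t = ereal (ln r)" using r real by (simp add: log_ennreal_def)
    with le rhs have "ln r / real n \<le> - ln q / real n - \<gamma>" by simp
    then have "ln r + ln q \<le> - (real n * \<gamma>)" using n by (simp add: field_simps)
    then have "ln (r * q) \<le> - (real n * \<gamma>)" using r q by (simp add: ln_mult)
    then have "r * q \<le> exp (- (real n * \<gamma>))"
      using r q by (metis exp_le_cancel_iff exp_ln mult_pos_pos)
    then show ?thesis using r q real by (simp flip: ennreal_mult)
  next
    case top
    then show ?thesis using le rhs n by (simp add: log_ennreal_def)
  qed
qed auto

theorem theorem5p2:
  fixes V :: "'v set" and X :: "'x measure" and Y :: "'y measure"
    and P :: "nat \<Rightarrow> (nat \<Rightarrow> 'v) pmf"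
    and W :: "nat \<Rightarrow> (nat \<Rightarrow> 'x) \<Rightarrow> (nat \<Rightarrow> 'y) measure"
    and \<epsilon> :: real
  assumes "0 \<le> \<epsilon>" and "\<epsilon> < 1"
    and "general_source V P"
    and "general_channel X Y W"
    and "transmissible \<epsilon> V P X Y W"
  shows "\<exists>Q. correlated_input P X Q \<and>
    (\<forall>\<gamma> :: nat \<Rightarrow> real.
       (\<forall>n\<ge>1. \<gamma> n > 0) \<longrightarrow> \<gamma> \<longlonglongrightarrow> 0 \<longrightarrow>
       filterlim (\<lambda>n. real n * \<gamma> n) at_top sequentially \<longrightarrow>
       limsup (\<lambda>n. let T = joint_law X Y n (Q n) (W n) in
          ereal (\<P>((v, x, y) in T.
            ereal (1 / real n) * log_ennreal (density_ratio X Y n T (x, y))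
              \<le> ereal (1 / real n) * log_ennreal (1 / ennreal (pmf (P n) v)) - ereal (\<gamma> n))))
        \<le> ereal \<epsilon>)"
proof -
  from assms(5) obtain \<phi> \<psi> where code: "\<And>n. n \<ge> 1 \<Longrightarrow> joint_code V X Y n (\<phi> n) (\<psi> n)"
    and err: "limsup (\<lambda>n. ereal (error_prob V Y n (P n) (W n) (\<phi> n) (\<psi> n))) \<le> ereal \<epsilon>"
    unfolding transmissible_def by blast
  have V: "countable V" and P: "\<And>n. n \<ge> 1 \<Longrightarrow> set_pmf (P n) \<subseteq> words V n"
    using assms(3) by (auto simp: general_source_def)
  have W: "\<And>n. n \<ge> 1 \<Longrightarrow> W n \<in> block X n \<rightarrow>\<^sub>M prob_algebra (block Y n)"
    using assms(4) by (auto simp: general_channel_def)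
  \<comment> \<open>Functions that are not words over \<open>V\<close> may be encoded to points outside the input space;
    redirecting them to a word of positive probability makes the encoder total.\<close>
  define \<phi>' where "\<phi>' = (\<lambda>n v. \<phi> n (if v \<in> words V n then v else (SOME u. u \<in> set_pmf (P n))))"
  have \<phi>': "\<phi>' n v \<in> space (block X n)" if "n \<ge> 1" for n v
  proof -
    have "(SOME u. u \<in> set_pmf (P n)) \<in> set_pmf (P n)"
      using set_pmf_not_empty[of "P n"] by (simp only: some_in_eq) simp
    then have "(SOME u. u \<in> set_pmf (P n)) \<in> words V n" using P[OF that] by auto
    then show ?thesis using code[OF that] by (auto simp: \<phi>'_def joint_code_def)
  qed
  have err': "error_prob V Y n (P n) (W n) (\<phi>' n) (\<psi> n) = error_prob V Y n (P n) (W n) (\<phi> n) (\<psi> n)" for n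
    unfolding error_prob_def by (intro infsum_cong) (simp add: \<phi>'_def)
  define Q where "Q = (\<lambda>n. encoded_input (block X n) (\<phi>' n) (P n))"
  have Q: "correlated_input P X Q"
    unfolding correlated_input_def Q_def using encoded_input_props[OF \<phi>'] by auto
  have "limsup (\<lambda>n. let T = joint_law X Y n (Q n) (W n) in
          ereal (\<P>((v, x, y) in T.
            ereal (1 / real n) * log_ennreal (density_ratio X Y n T (x, y))
              \<le> ereal (1 / real n) * log_ennreal (1 / ennreal (pmf (P n) v)) - ereal (\<gamma> n))))
        \<le> ereal \<epsilon>"
    if \<gamma>: "filterlim (\<lambda>n. real n * \<gamma> n) at_top sequentially" for \<gamma> :: "nat \<Rightarrow> real"
  proof -
    define c where "c = (\<lambda>n. exp (- (real n * \<gamma> n)))"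
    define e where "e = (\<lambda>n. error_prob V Y n (P n) (W n) (\<phi> n) (\<psi> n))"
    have "c \<longlonglongrightarrow> 0"
      unfolding c_def using \<gamma>
      by (intro filterlim_compose[OF exp_at_bot] filterlim_compose[OF filterlim_uminus_at_bot_at_top])
    then have c0: "(\<lambda>n. ereal (c n)) \<longlonglongrightarrow> 0" by (simp add: zero_ereal_def)
    have bound: "(let T = joint_law X Y n (Q n) (W n) in
          ereal (\<P>((v, x, y) in T.
            ereal (1 / real n) * log_ennreal (density_ratio X Y n T (x, y))
              \<le> ereal (1 / real n) * log_ennreal (1 / ennreal (pmf (P n) v)) - ereal (\<gamma> n))))
        \<le> ereal (c n) + ereal (e n)" if n: "n \<ge> 1" for n
    proof -
      define T where "T = joint_law X Y n (Q n) (W n)"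
      let ?A = "{(v, x, y) \<in> space T. ereal (1 / real n) * log_ennreal (density_ratio X Y n T (x, y))
              \<le> ereal (1 / real n) * log_ennreal (1 / ennreal (pmf (P n) v)) - ereal (\<gamma> n)}"
      let ?B = "{(v, x, y) \<in> space T. density_ratio X Y n T (x, y) * ennreal (pmf (P n) v) \<le> ennreal (c n)}"
      have \<psi>: "\<psi> n \<in> block Y n \<rightarrow>\<^sub>M count_space (words V n)"
        using code[OF n] by (simp add: joint_code_def)
      have c: "0 \<le> c n" by (simp add: c_def)
      note low = low_density_prob_le_error_prob[where \<phi> = "\<phi>' n" and p = "P n",
        OF V P[OF n] W[OF n] \<phi>'[OF n] \<psi> c, folded T_def[unfolded Q_def]]
      interpret T: prob_space T
        unfolding T_def Q_def by (rule prob_space_joint_law_encoded[where \<phi> = "\<phi>' n", OF \<phi>'[OF n] W[OF n]])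
      have "measure T ?A \<le> measure T ?B"
        using low(2) log_ennreal_le_imp_mult_le[OF n pmf_nonneg]
        by (intro T.finite_measure_mono) (auto simp: c_def)
      also have "\<dots> \<le> e n + c n" using low(1) by (simp add: e_def err' case_prod_beta')
      finally show ?thesis by (simp add: T_def Let_def case_prod_beta' add.commute)
    qed
    have "limsup (\<lambda>n. let T = joint_law X Y n (Q n) (W n) in
          ereal (\<P>((v, x, y) in T.
            ereal (1 / real n) * log_ennreal (density_ratio X Y n T (x, y))
              \<le> ereal (1 / real n) * log_ennreal (1 / ennreal (pmf (P n) v)) - ereal (\<gamma> n))))
        \<le> limsup (\<lambda>n. ereal (c n) + ereal (e n))"
      using bound by (intro Limsup_mono eventually_sequentiallyI[of 1])
    also have "\<dots> = 0 + limsup (\<lambda>n. ereal (e n))"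
      using c0 by (intro ereal_limsup_lim_add) auto
    also have "\<dots> \<le> ereal \<epsilon>" using err by (simp add: e_def)
    finally show ?thesis .
  qed
  with Q show ?thesis by blast
qed

end
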